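(* Let $(D,\vdash,\dashv)$ be an associative dialgebra over $\phi$. Define, for all $a,b,c\in D$, $$\{a,b,c\}_{1}=(a\dashv b)\dashv c=a\dashv(b\dashv c),\quad \{a,b,c\}_{2}=(a\vdash b)\dashv c=a\vdash(b\dashv c),\quad \{a,b,c\}_{3}=(a\vdash b)\vdash c=a\vdash(b\vdash c).$$ Then $D$ with these three triple products is an associative triple trisystem of the first kind.
   Context: $\phi$ is a scalar ring (commutative, unital) with $\frac12\in\phi$. An associative dialgebra is a $\phi$-module $D$ with two bilinear products $\dashv,\vdash$ satisfying, for all $a,b,c\in D$: $(a\dashv b)\dashv c=a\dashv(b\dashv c)$; $(a\vdash b)\dashv c=a\vdash(b\dashv c)$; $(a\vdash b)\vdash c=a\vdash(b\vdash c)$; $a\dashv(b\dashv c)=a\dashv(b\vdash c)$; $(a\dashv b)\vdash c=(a\vdash b)\vdash c$. An associative triple trisystem of the first kind is a $\phi$-module $A$ with three trilinear maps $\{\,,\,,\,\}_i:A\times A\times A\to A$, $i\in\{1,2,3\}$, satisfying for all $a,b,c,d,e\in A$: (1) $\{\{a,b,c\}_1,d,e\}_1=\{a,\{b,c,d\}_1,e\}_1=\{a,b,\{c,d,e\}_1\}_1$; (2) $\{\{a,b,c\}_2,d,e\}_1=\{a,\{b,c,d\}_1,e\}_2=\{a,b,\{c,d,e\}_1\}_2$; (3) $\{\{a,b,c\}_3,d,e\}_1=\{a,\{b,c,d\}_2,e\}_2=\{a,b,\{c,d,e\}_1\}_3$; (4) $\{\{a,b,c\}_3,d,e\}_2=\{a,\{b,c,d\}_3,e\}_2=\{a,b,\{c,d,e\}_2\}_3$;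 (5) $\{\{a,b,c\}_3,d,e\}_3=\{a,\{b,c,d\}_3,e\}_3=\{a,b,\{c,d,e\}_3\}_3$; (6) $\{\{a,b,c\}_1,d,e\}_2=\{\{a,b,c\}_2,d,e\}_2=\{\{a,b,c\}_3,d,e\}_2$; (7) $\{\{a,b,c\}_1,d,e\}_3=\{\{a,b,c\}_2,d,e\}_3=\{\{a,b,c\}_3,d,e\}_3$; (8) $\{a,\{b,c,d\}_1,e\}_1=\{a,\{b,c,d\}_2,e\}_1=\{a,\{b,c,d\}_3,e\}_1$; (9) $\{a,\{b,c,d\}_1,e\}_3=\{a,\{b,c,d\}_2,e\}_3=\{a,\{b,c,d\}_3,e\}_3$; (10) $\{a,b,\{c,d,e\}_1\}_1=\{a,b,\{c,d,e\}_2\}_1=\{a,b,\{c,d,e\}_3\}_1$; (11) $\{a,b,\{c,d,e\}_1\}_2=\{a,b,\{c,d,e\}_2\}_2=\{a,b,\{c,d,e\}_3\}_2$. *)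

theory Defs
  imports "HOL-Algebra.Module"
begin

text \<open>
  Modules are those of \<^theory>\<open>HOL-Algebra.Module\<close>. Their record type also carries ring
  fields \<open>mult\<close> and \<open>one\<close>; the locale \<^locale>\<open>module\<close> says nothing about them
  and they are not used here, so the products are separate parameters.
\<close>

definition linear_map ::
  "('r, 'm) ring_scheme \<Rightarrow> ('r, 'a, 'k) module_scheme \<Rightarrow> ('a \<Rightarrow> 'a) \<Rightarrow> bool" where
  "linear_map R M f \<longleftrightarrow>
     f \<in> carrier M \<rightarrow> carrier M \<and>
     (\<forall>x\<in>carrier M. \<forall>y\<in>carrier M. f (x \<oplus>\<^bsub>M\<^esub> y) = f x \<oplus>\<^bsub>M\<^esub> f y) \<and>
     (\<forall>r\<in>carrier R. \<forall>x\<in>carrier M. f (r \<odot>\<^bsub>M\<^esub> x) = r \<odot>\<^bsub>M\<^esub> f x)"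

definition bilinear_map ::
  "('r, 'm) ring_scheme \<Rightarrow> ('r, 'a, 'k) module_scheme \<Rightarrow> ('a \<Rightarrow> 'a \<Rightarrow> 'a) \<Rightarrow> bool" where
  "bilinear_map R M f \<longleftrightarrow>
     (\<forall>b\<in>carrier M. linear_map R M (\<lambda>a. f a b)) \<and>
     (\<forall>a\<in>carrier M. linear_map R M (\<lambda>b. f a b))"

definition trilinear_map ::
  "('r, 'm) ring_scheme \<Rightarrow> ('r, 'a, 'k) module_scheme \<Rightarrow> ('a \<Rightarrow> 'a \<Rightarrow> 'a \<Rightarrow> 'a) \<Rightarrow> bool" where
  "trilinear_map R M f \<longleftrightarrow>
     (\<forall>b\<in>carrier M. \<forall>c\<in>carrier M. linear_map R M (\<lambda>a. f a b c)) \<and>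
     (\<forall>a\<in>carrier M. \<forall>c\<in>carrier M. linear_map R M (\<lambda>b. f a b c)) \<and>
     (\<forall>a\<in>carrier M. \<forall>b\<in>carrier M. linear_map R M (\<lambda>c. f a b c))"

locale module_with_half = module R M
  for R (structure) and M (structure) +
  assumes two_unit: "\<one>\<^bsub>R\<^esub> \<oplus>\<^bsub>R\<^esub> \<one>\<^bsub>R\<^esub> \<in> Units R"

locale associative_dialgebra = module_with_half R D
  for R (structure) and D (structure)
    and left_prod :: "'b \<Rightarrow> 'b \<Rightarrow> 'b" (infixl \<open>\<stileturn>\<close> 70)
    and right_prod :: "'b \<Rightarrow> 'b \<Rightarrow> 'b" (infixl \<open>\<turnstile>\<close> 70) +
  assumes bilinear_left: "bilinear_map R D (\<stileturn>)"
    and bilinear_right: "bilinear_map R D (\<turnstile>)"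
    and left_assoc:
      "\<lbrakk>a \<in> carrier D; b \<in> carrier D; c \<in> carrier D\<rbrakk> \<Longrightarrow> (a \<stileturn> b) \<stileturn> c = a \<stileturn> (b \<stileturn> c)"
    and inner_assoc:
      "\<lbrakk>a \<in> carrier D; b \<in> carrier D; c \<in> carrier D\<rbrakk> \<Longrightarrow> (a \<turnstile> b) \<stileturn> c = a \<turnstile> (b \<stileturn> c)"
    and right_assoc:
      "\<lbrakk>a \<in> carrier D; b \<in> carrier D; c \<in> carrier D\<rbrakk> \<Longrightarrow> (a \<turnstile> b) \<turnstile> c = a \<turnstile> (b \<turnstile> c)"
    and left_bar:
      "\<lbrakk>a \<in> carrier D; b \<in> carrier D; c \<in> carrier D\<rbrakk> \<Longrightarrow> a \<stileturn> (b \<stileturn> c) = a \<stileturn> (b \<turnstile> c)"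
    and right_bar:
      "\<lbrakk>a \<in> carrier D; b \<in> carrier D; c \<in> carrier D\<rbrakk> \<Longrightarrow> (a \<stileturn> b) \<turnstile> c = (a \<turnstile> b) \<turnstile> c"

locale associative_trisystem_first_kind = module_with_half R A
  for R (structure) and A (structure)
    and T1 :: "'b \<Rightarrow> 'b \<Rightarrow> 'b \<Rightarrow> 'b"
    and T2 :: "'b \<Rightarrow> 'b \<Rightarrow> 'b \<Rightarrow> 'b"
    and T3 :: "'b \<Rightarrow> 'b \<Rightarrow> 'b \<Rightarrow> 'b" +
  assumes trilinear1: "trilinear_map R A T1"
    and trilinear2: "trilinear_map R A T2"
    and trilinear3: "trilinear_map R A T3"
    and identities:
      "\<lbrakk>a \<in> carrier A; b \<in> carrier A; c \<in> carrier A; d \<in> carrier A; e \<in> carrier A\<rbrakk> \<Longrightarrow>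
         (T1 (T1 a b c) d e = T1 a (T1 b c d) e \<and> T1 a (T1 b c d) e = T1 a b (T1 c d e)) \<and>
         (T1 (T2 a b c) d e = T2 a (T1 b c d) e \<and> T2 a (T1 b c d) e = T2 a b (T1 c d e)) \<and>
         (T1 (T3 a b c) d e = T2 a (T2 b c d) e \<and> T2 a (T2 b c d) e = T3 a b (T1 c d e)) \<and>
         (T2 (T3 a b c) d e = T2 a (T3 b c d) e \<and> T2 a (T3 b c d) e = T3 a b (T2 c d e)) \<and>
         (T3 (T3 a b c) d e = T3 a (T3 b c d) e \<and> T3 a (T3 b c d) e = T3 a b (T3 c d e)) \<and>
         (T2 (T1 a b c) d e = T2 (T2 a b c) d e \<and> T2 (T2 a b c) d e = T2 (T3 a b c) d e) \<and>
         (T3 (T1 a b c) d e = T3 (T2 a b c) d e \<and> T3 (T2 a b c) d e = T3 (T3 a b c) d e) \<and>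
         (T1 a (T1 b c d) e = T1 a (T2 b c d) e \<and> T1 a (T2 b c d) e = T1 a (T3 b c d) e) \<and>
         (T3 a (T1 b c d) e = T3 a (T2 b c d) e \<and> T3 a (T2 b c d) e = T3 a (T3 b c d) e) \<and>
         (T1 a b (T1 c d e) = T1 a b (T2 c d e) \<and> T1 a b (T2 c d e) = T1 a b (T3 c d e)) \<and>
         (T2 a b (T1 c d e) = T2 a b (T2 c d e) \<and> T2 a b (T2 c d e) = T2 a b (T3 c d e))"

end

theory Submission
  imports Defs
begin

text \<open>Trilinearity only evaluates a map on the carrier, since sums and scalar multiples stay
  there. This matters because \<open>T1\<close>, \<open>T2\<close>, \<open>T3\<close> are prescribed
  only on the carrier and may differ elsewhere from the composites of dialgebra products.\<close>

lemma trilinear_map_cong: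
  assumes "\<And>a b c. \<lbrakk>a \<in> carrier M; b \<in> carrier M; c \<in> carrier M\<rbrakk> \<Longrightarrow> f a b c = g a b c"
    and "module R M"
  shows "trilinear_map R M f \<longleftrightarrow> trilinear_map R M g"
proof -
  interpret module R M by fact
  show ?thesis
    using assms(1) unfolding trilinear_map_def linear_map_def Pi_iff by simp
qed

lemma trilinear_map_bilinear_comp:
  assumes "bilinear_map R M f" and "bilinear_map R M g"
  shows "trilinear_map R M (\<lambda>a b c. g (f a b) c)"
  using assms unfolding trilinear_map_def bilinear_map_def linear_map_def Pi_iff by simp

lemma bilinear_map_closed:
  assumes "bilinear_map R M f" and "a \<in> carrier M" and "b \<in> carrier M"
  shows "f a b \<in> carrier M"
  using assms unfolding bilinear_map_def linear_map_def by blast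

theorem proposition1:
  fixes R :: "('r, 'm) ring_scheme"
    and D :: "('r, 'b, 'k) module_scheme"
    and left_prod :: "'b \<Rightarrow> 'b \<Rightarrow> 'b" (infixl \<open>\<stileturn>\<close> 70)
    and right_prod :: "'b \<Rightarrow> 'b \<Rightarrow> 'b" (infixl \<open>\<turnstile>\<close> 70)
    and T1 T2 T3 :: "'b \<Rightarrow> 'b \<Rightarrow> 'b \<Rightarrow> 'b"
  assumes "associative_dialgebra R D (\<stileturn>) (\<turnstile>)"
    and "\<And>a b c. \<lbrakk>a \<in> carrier D; b \<in> carrier D; c \<in> carrier D\<rbrakk> \<Longrightarrow> T1 a b c = (a \<stileturn> b) \<stileturn> c"
    and "\<And>a b c. \<lbrakk>a \<in> carrier D; b \<in> carrier D; c \<in> carrier D\<rbrakk> \<Longrightarrow> T2 a b c = (a \<turnstile> b) \<stileturn> c"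
    and "\<And>a b c. \<lbrakk>a \<in> carrier D; b \<in> carrier D; c \<in> carrier D\<rbrakk> \<Longrightarrow> T3 a b c = (a \<turnstile> b) \<turnstile> c"
  shows "(\<forall>a\<in>carrier D. \<forall>b\<in>carrier D. \<forall>c\<in>carrier D.
            T1 a b c = a \<stileturn> (b \<stileturn> c) \<and>
            T2 a b c = a \<turnstile> (b \<stileturn> c) \<and>
            T3 a b c = a \<turnstile> (b \<turnstile> c)) \<and>
         associative_trisystem_first_kind R D T1 T2 T3"
proof -
  interpret associative_dialgebra R D "(\<stileturn>)" "(\<turnstile>)" by fact
  note T = assms(2-4)
  note closed = bilinear_map_closed[OF bilinear_left] bilinear_map_closed[OF bilinear_right]
  \<comment> \<open>Oriented so that every product of \<open>x\<^sub>1, \<dots>, x\<^sub>n\<close> is rewritten to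
    \<open>x\<^sub>1 \<turnstile> (\<dots> \<turnstile> (x\<^sub>i \<stileturn> (\<dots> \<stileturn> x\<^sub>n)))\<close>, where \<open>x\<^sub>i\<close> is the centre of the product.\<close>
  note normalize = left_assoc inner_assoc right_assoc left_bar[symmetric] right_bar
  have "associative_trisystem_first_kind R D T1 T2 T3"
  proof unfold_locales
    \<comment> \<open>The left bracketing exhibits each triple product on the carrier as
      \<open>g (f a b) c\<close>, where \<open>f\<close> and \<open>g\<close> are dialgebra
      products.\<close>
    show "trilinear_map R D T1" "trilinear_map R D T2" "trilinear_map R D T3"
      using bilinear_left bilinear_right
      by (simp_all add: trilinear_map_cong[OF T(1) module_axioms]
          trilinear_map_cong[OF T(2) module_axioms] trilinear_map_cong[OF T(3) module_axioms]
          trilinear_map_bilinear_comp)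
  \<comment> \<open>What remains is \<open>identities\<close>. \<open>T1\<close>, \<open>T2\<close>,
    \<open>T3\<close> put the centre at the first, second, third argument, so within each chain all
    terms have centre at the same letter: a, b, c, d, e for the first five chains, then d, e, a, e,
    a, b. The facts \<open>closed\<close> discharge the carrier premises of the rewriting.\<close>
  qed (simp add: T closed normalize)
  then show ?thesis by (simp add: T closed normalize)
qed

end
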